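(* Let $P$ be a set of $n$ points in the plane in convex position (no three collinear) and let $K(P)$ be the complete geometric graph on $P$. For every $k \in \mathbb{N}$, $K(P)$ admits a partition into at most $\frac{n}{\sqrt{2k}}$ $k$-planar subgraphs. More precisely, for every $s > 2$, $K(P)$ admits a partition into $\lceil\frac{n}{s}\rceil$ subgraphs each of which is $\frac{(s-1)(s-2)}{2}$-planar. Conversely, for every $k \in \mathbb{N}$, any partition of $K(P)$ into $k$-planar subgraphs consists of at least $\frac{n-1}{4.93\sqrt{k}}$ subgraphs.
   Context: A geometric graph is a graph drawn in the plane with vertices as points in general position (no three collinear) and edges as straight-line segments. The complete geometric graph $K(P)$ has vertex set $P$ and all segments between points of $P$ as edges. Two edges cross if they share a point in their relative interiors. A geometric graph is $k$-planar if every edge crosses at most $k$ other edges of the graph. A partition of a graph $G$ is a set of edge-disjoint subgraphs of $G$ whose union is $G$.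
   Formalization: The first bound is proved as at most ⌈n/√(2k)⌉ subgraphs, since without rounding it fails (n = 2, k = 3 gives a bound below 1 although there is an edge); k is a positive integer and s an integer greater than 2. *)

theory Defs
  imports "HOL-Analysis.Analysis"
begin

type_synonym point = "real ^ 2"

text \<open>
  An edge is the two-element set of its end points; the segment it is drawn as
  is the convex hull of that set.
\<close>

record geo_graph =
  verts :: "point set"
  edges :: "point set set"

definition general_position :: "point set \<Rightarrow> bool" where
  "general_position P \<longleftrightarrow>
     (\<forall>a\<in>P. \<forall>b\<in>P. \<forall>c\<in>P. a \<noteq> b \<and> b \<noteq> c \<and> a \<noteq> c \<longrightarrow> \<not> collinear {a, b, c})"

definition convex_position :: "point set \<Rightarrow> bool" where
  "convex_position P \<longleftrightarrow> (\<forall>p\<in>P. p \<notin> convex hull (P - {p}))"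

definition geometric_graph :: "geo_graph \<Rightarrow> bool" where
  "geometric_graph G \<longleftrightarrow>
     finite (verts G) \<and> general_position (verts G) \<and>
     (\<forall>e\<in>edges G. e \<subseteq> verts G \<and> card e = 2)"

definition complete_geometric_graph :: "point set \<Rightarrow> geo_graph" where
  "complete_geometric_graph P = \<lparr>verts = P, edges = {e. e \<subseteq> P \<and> card e = 2}\<rparr>"

definition crosses :: "point set \<Rightarrow> point set \<Rightarrow> bool" where
  "crosses e f \<longleftrightarrow>
     e \<noteq> f \<and> rel_interior (convex hull e) \<inter> rel_interior (convex hull f) \<noteq> {}"

definition k_planar :: "nat \<Rightarrow> geo_graph \<Rightarrow> bool" where
  "k_planar k G \<longleftrightarrow>
     geometric_graph G \<and> (\<forall>e\<in>edges G. card {f \<in> edges G. crosses e f} \<le> k)"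

definition subgraph :: "geo_graph \<Rightarrow> geo_graph \<Rightarrow> bool" where
  "subgraph H G \<longleftrightarrow>
     geometric_graph H \<and> verts H \<subseteq> verts G \<and> edges H \<subseteq> edges G"

definition graph_partition :: "geo_graph set \<Rightarrow> geo_graph \<Rightarrow> bool" where
  "graph_partition \<H> G \<longleftrightarrow>
     (\<forall>H\<in>\<H>. subgraph H G) \<and>
     (\<forall>H\<in>\<H>. \<forall>H'\<in>\<H>. H \<noteq> H' \<longrightarrow> edges H \<inter> edges H' = {}) \<and>
     (\<Union>H\<in>\<H>. verts H) = verts G \<and> (\<Union>H\<in>\<H>. edges H) = edges G"

end

theory Submission
  imports Defs
begin

text \<open>
  Number the points \<open>v 0, \<dots>, v (n - 1)\<close> along the hull, so that two edges cross iff their index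
  pairs interleave.

  Upper bound: the edges \<open>{v i, v j}\<close> with a fixed \<open>(i + j) mod n\<close> form a class of pairwise
  noncrossing edges, and an edge crosses at most \<open>d - 1\<close> edges of the class \<open>d\<close> steps away. Hence
  \<open>s\<close> consecutive classes form a \<open>(s - 1)(s - 2) / 2\<close>-planar graph.

  Lower bound: let a partition have \<open>t\<close> parts and restrict it to \<open>s\<close> of the points. Noncrossing
  diagonals of an \<open>s\<close>-gon number at most \<open>s - 3\<close>, so the \<open>s (s - 3) / 2\<close> diagonals cause at least
  \<open>s (s - 3) / 2 - t (s - 3)\<close> crossings within parts. Averaging over all \<open>s\<close>-subsets bounds the total
  number of crossings within parts from below; it is at most \<open>k / 2\<close> times the number of edges.
  Treating all parts together is what makes this work: the hull edges of a sample, which cross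
  nothing, are counted only once instead of once per part.
\<close>

section \<open>Orientation and crossing segments\<close>

text \<open>Twice the signed area of the triangle \<open>a b c\<close>, positive exactly when the
  triangle is traversed counterclockwise.\<close>

definition orient :: "point \<Rightarrow> point \<Rightarrow> point \<Rightarrow> real" where
  "orient a b c = (b$1 - a$1) * (c$2 - a$2) - (b$2 - a$2) * (c$1 - a$1)"

lemma orient_rotate: "orient b c a = orient a b c"
  by (simp add: orient_def algebra_simps)

lemma orient_swap: "orient a c b = - orient a b c"
  by (simp add: orient_def algebra_simps)

lemma orient_combination:
  "orient a c ((1 - u) *\<^sub>R b + u *\<^sub>R d) = (1 - u) * orient a c b + u * orient a c d"
  by (simp add: orient_def algebra_simps)

lemma orient_degenerate [simp]: "orient a b a = 0" "orient a b b = 0" "orient a a b = 0"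
  by (simp_all add: orient_def)

text \<open>The affine dependence between four points of the plane. By \<open>orient_sum\<close>
  both sides have the same total weight, so division by it describes one point both on the line
  \<open>a c\<close> and on the line \<open>b d\<close>.\<close>

lemma orient_affine_dependence:
  "orient b c d *\<^sub>R a + orient a b d *\<^sub>R c = orient a c d *\<^sub>R b + orient a b c *\<^sub>R d"
  by (simp add: orient_def vec_eq_iff forall_2 algebra_simps)

lemma orient_sum: "orient b c d + orient a b d = orient a c d + orient a b c"
  by (simp add: orient_def algebra_simps)

lemma collinear_if_orient_eq_0:
  assumes "orient a b c = 0"
  shows "collinear {a, b, c}"
proof (cases "b = a")
  case False
  have "\<exists>t. c - a = t *\<^sub>R (b - a)"
  proof (cases "b$1 = a$1")
    case True
    then have ne: "b$2 \<noteq> a$2"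
      using False by (auto simp: vec_eq_iff forall_2)
    have "c$1 = a$1"
      using assms True ne by (simp add: orient_def)
    then have "c - a = ((c$2 - a$2) / (b$2 - a$2)) *\<^sub>R (b - a)"
      using True ne by (simp add: vec_eq_iff forall_2)
    then show ?thesis ..
  next
    case ne: False
    have "(c$2 - a$2) * (b$1 - a$1) = (c$1 - a$1) * (b$2 - a$2)"
      using assms by (simp add: orient_def mult.commute)
    then have "c$2 - a$2 = (c$1 - a$1) * (b$2 - a$2) / (b$1 - a$1)"
      using ne by (subst nonzero_eq_divide_eq) simp_all
    then have "c - a = ((c$1 - a$1) / (b$1 - a$1)) *\<^sub>R (b - a)"
      using ne by (simp add: vec_eq_iff forall_2)
    then show ?thesis ..
  qed
  then have "collinear {0, b - a, c - a}"
    by (auto simp: collinear_lemma)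
  then have "collinear {b, a, c}"
    using collinear_3[of b a c] by (simp add: insert_commute)
  then show ?thesis
    by (simp add: insert_commute)
qed simp

lemma rel_interior_hull_pair:
  "a \<noteq> b \<Longrightarrow> rel_interior (convex hull {a, b}) = open_segment a b"
  for a b :: point
  by (simp add: rel_interior_closed_segment flip: segment_convex_hull)

text \<open>Dividing the affine dependence by its total weight \<open>W\<close> gives a point
  \<open>x\<close> that is a convex combination of \<open>a\<close> and \<open>c\<close> and also of
  \<open>b\<close> and \<open>d\<close>. All four weights are positive, so \<open>x\<close> is
  interior to both segments.\<close>

lemma crosses_if_alternating:
  assumes "orient a b c > 0" "orient a b d > 0" "orient a c d > 0" "orient b c d > 0"
  shows "crosses {a, c} {b, d}"
proof -
  define W where "W = orient b c d + orient a b d"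
  have W: "W = orient a c d + orient a b c" "W > 0"
    using assms orient_sum[of b c d a] by (auto simp: W_def)
  have ne: "a \<noteq> c" "b \<noteq> d" "a \<noteq> b" "a \<noteq> d"
    using assms by auto
  define x where "x = (1 - orient a b d / W) *\<^sub>R a + (orient a b d / W) *\<^sub>R c"
  have c1: "1 - orient a b d / W = orient b c d / W" and c2: "orient a c d / W = 1 - orient a b c / W"
    using W by (auto simp: W_def divide_simps)
  have "x = (1 / W) *\<^sub>R (orient b c d *\<^sub>R a + orient a b d *\<^sub>R c)"
    by (simp add: x_def c1 scaleR_add_right)
  also have "\<dots> = (1 / W) *\<^sub>R (orient a c d *\<^sub>R b + orient a b c *\<^sub>R d)"
    by (simp only: orient_affine_dependence)
  also have "\<dots> = (1 - orient a b c / W) *\<^sub>R b + (orient a b c / W) *\<^sub>R d"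
    by (simp add: scaleR_add_right c2)
  finally have x': "x = (1 - orient a b c / W) *\<^sub>R b + (orient a b c / W) *\<^sub>R d" .
  have "x \<in> open_segment a c"
    unfolding in_segment
  proof (intro conjI exI[of _ "orient a b d / W"])
    show "orient a b d / W < 1"
      using assms W(2) by (simp add: W_def divide_simps)
  qed (use ne assms W(2) x_def in auto)
  moreover have "x \<in> open_segment b d"
    unfolding in_segment
  proof (intro conjI exI[of _ "orient a b c / W"])
    show "orient a b c / W < 1"
      using assms W by (simp add: divide_simps)
  qed (use ne assms W(2) x' in auto)
  ultimately show ?thesis
    using ne by (auto simp: crosses_def rel_interior_hull_pair doubleton_eq_iff)
qed

text \<open>The map \<open>orient a c\<close> is affine and vanishes on the line \<open>a c\<close>.
  At an interior point of \<open>b d\<close> it is a proper mixture of two values of equal sign that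
  are not both zero, hence nonzero.\<close>

lemma not_crosses_if_same_side:
  assumes "a \<noteq> c" "b \<noteq> d"
    and "orient a c b * orient a c d \<ge> 0" "orient a c b \<noteq> 0 \<or> orient a c d \<noteq> 0"
  shows "\<not> crosses {a, c} {b, d}"
proof
  assume "crosses {a, c} {b, d}"
  then obtain x where x: "x \<in> open_segment a c" "x \<in> open_segment b d"
    using assms(1,2) by (auto simp: crosses_def rel_interior_hull_pair)
  have "orient a c x = 0"
    using x(1) by (auto simp: in_segment orient_combination)
  moreover obtain u where u: "0 < u" "u < 1" "x = (1 - u) *\<^sub>R b + u *\<^sub>R d"
    using x(2) by (auto simp: in_segment)
  ultimately have eq: "(1 - u) * orient a c b + u * orient a c d = 0"
    by (simp add: orient_combination)
  \<comment> \<open>Multiplying by \<open>orient a c b\<close> turns the mixture into a sum of two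
    nonnegative terms, which treats both signs at once.\<close>
  have "(1 - u) * (orient a c b)\<^sup>2 + u * (orient a c b * orient a c d)
      = orient a c b * ((1 - u) * orient a c b + u * orient a c d)"
    by (simp add: algebra_simps power2_eq_square)
  then have "(1 - u) * (orient a c b)\<^sup>2 + u * (orient a c b * orient a c d) = 0"
    by (simp add: eq)
  moreover have "(1 - u) * (orient a c b)\<^sup>2 \<ge> 0" "u * (orient a c b * orient a c d) \<ge> 0"
    using u assms(3) by auto
  ultimately have "(1 - u) * (orient a c b)\<^sup>2 = 0"
    by linarith
  then have "orient a c b = 0"
    using u by simp
  with eq u assms(4) show False
    by simp
qed

section \<open>Enumerating a convex point set in counterclockwise order\<close>

lemma finite_lower_bound_real:
  fixes f :: "'a \<Rightarrow> real"
  assumes "finite A"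
  shows "\<exists>B. \<forall>x\<in>A. B < f x"
proof (intro exI ballI)
  fix x assume "x \<in> A"
  then have "Min (f ` A) \<le> f x"
    using assms by simp
  then show "Min (f ` A) - 1 < f x"
    by linarith
qed

text \<open>Otherwise the affine dependence, solved for \<open>b\<close> and divided by
  \<open>W\<close>, gives nonnegative barycentric coordinates of \<open>b\<close> in the triangle
  \<open>p a c\<close>, against convex position.\<close>

lemma orient_triple_pos:
  assumes "convex_position P" "general_position P"
    and "{p, a, b, c} \<subseteq> P"
    and "orient p a b > 0" "orient p b c > 0" "orient p a c > 0"
  shows "orient a b c > 0"
proof (rule ccontr)
  assume neg: "\<not> orient a b c > 0"
  define W where "W = orient p a c"
  have ne: "b \<noteq> p" "b \<noteq> a" "b \<noteq> c"
    using assms(4-6) by auto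
  have "W *\<^sub>R b = (- orient a b c) *\<^sub>R p + orient p b c *\<^sub>R a + orient p a b *\<^sub>R c"
    using orient_affine_dependence[of a b c p] by (simp add: W_def algebra_simps)
  moreover have "b = (1 / W) *\<^sub>R (W *\<^sub>R b)"
    using assms(6) by (simp add: W_def)
  ultimately have b: "b = (- orient a b c / W) *\<^sub>R p + (orient p b c / W) *\<^sub>R a + (orient p a b / W) *\<^sub>R c"
    by (simp add: scaleR_add_right scaleR_diff_right)
  have "b \<in> convex hull {p, a, c}"
    unfolding convex_hull_3
  proof (intro CollectI exI conjI)
    show "b = (- orient a b c / W) *\<^sub>R p + (orient p b c / W) *\<^sub>R a + (orient p a b / W) *\<^sub>R c"
      by (rule b)
    show "- orient a b c / W + orient p b c / W + orient p a b / W = 1"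
      using orient_sum[of a b c p] assms(6) by (simp add: W_def field_simps)
    show "0 \<le> - orient a b c / W" "0 \<le> orient p b c / W" "0 \<le> orient p a b / W"
      using neg assms(4-6) by (simp_all add: W_def divide_nonpos_pos)
  qed
  moreover have "convex hull {p, a, c} \<subseteq> convex hull (P - {b})"
    using assms(3) ne by (intro hull_mono) auto
  ultimately show False
    using assms(1,3) by (auto simp: convex_position_def)
qed

text \<open>Sort the points by the direction in which they are seen from a fixed point
  \<open>p\<close>. A line separating \<open>p\<close> from the other points confines these
  directions to an open half-plane, so their cyclic order is linear.\<close>

lemma ccw_key:
  assumes "finite P" "convex_position P" "general_position P"
  shows "\<exists>g::point \<Rightarrow> real. inj_on g P \<and>
    (\<forall>a\<in>P. \<forall>b\<in>P. \<forall>c\<in>P. g a < g b \<longrightarrow> g b < g c \<longrightarrow> orient a b c > 0)"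
proof (cases "P = {}")
  case True
  then show ?thesis
    by simp
next
  case False
  then obtain p where p: "p \<in> P"
    by blast
  have "closed (convex hull (P - {p}))"
    using assms(1) by (intro compact_imp_closed compact_convex_hull finite_imp_compact) simp
  then obtain w \<beta> where w: "w \<bullet> p < \<beta>" "\<And>x. x \<in> convex hull (P - {p}) \<Longrightarrow> w \<bullet> x > \<beta>"
    using assms(2) p separating_hyperplane_closed_point[OF convex_convex_hull, of "P - {p}" p]
    by (auto simp: convex_position_def)
  have pos: "w$1 * (q$1 - p$1) + w$2 * (q$2 - p$2) > 0" if "q \<in> P" "q \<noteq> p" for q
  proof -
    have "w \<bullet> q > w \<bullet> p"
      using w(1) w(2)[OF hull_inc, of q] that by simp
    then show ?thesis
      by (simp add: inner_vec_def sum_2 algebra_simps)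
  qed
  \<comment> \<open>The tangent of the angle from \<open>w\<close> to \<open>q - p\<close>. The
    denominator is positive by \<open>pos\<close>, so the tangent increases with the angle.\<close>
  define slope where "slope q = (w$1 * (q$2 - p$2) - w$2 * (q$1 - p$1))
      / (w$1 * (q$1 - p$1) + w$2 * (q$2 - p$2))" for q :: point
  have w0: "(w$1)\<^sup>2 + (w$2)\<^sup>2 > 0" if "q \<in> P" "q \<noteq> p" for q
  proof -
    have "w$1 \<noteq> 0 \<or> w$2 \<noteq> 0"
      using pos[OF that] by fastforce
    then show ?thesis
      by (simp add: sum_power2_gt_zero_iff)
  qed
  have frac_less: "x / d < y / e \<longleftrightarrow> 0 < y * d - x * e" if "0 < d" "0 < e" for x y d e :: real
    using that by (simp add: divide_simps mult.commute)
  have slope_less: "slope a < slope b \<longleftrightarrow> orient p a b > 0"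
    if "a \<in> P" "b \<in> P" "a \<noteq> p" "b \<noteq> p" for a b
  proof -
    have "slope a < slope b \<longleftrightarrow> 0 <
        (w$1 * (b$2 - p$2) - w$2 * (b$1 - p$1)) * (w$1 * (a$1 - p$1) + w$2 * (a$2 - p$2)) -
        (w$1 * (a$2 - p$2) - w$2 * (a$1 - p$1)) * (w$1 * (b$1 - p$1) + w$2 * (b$2 - p$2))"
      unfolding slope_def using pos that by (intro frac_less) blast+
    \<comment> \<open>For vectors \<open>x\<close>, \<open>y\<close>: cross(w, y) dot(w, x) -
      cross(w, x) dot(w, y) = |w|^2 cross(x, y), used with \<open>a - p\<close> and
      \<open>b - p\<close>.\<close>
    also have "\<dots> \<longleftrightarrow> 0 < ((w$1)\<^sup>2 + (w$2)\<^sup>2) * orient p a b"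
      by (rule arg_cong[where f = "\<lambda>x. 0 < x"]) (simp add: orient_def algebra_simps power2_eq_square)
    also have "\<dots> \<longleftrightarrow> orient p a b > 0"
      using w0[of a] that by (simp add: zero_less_mult_iff)
    finally show ?thesis .
  qed
  obtain B where "\<forall>q\<in>P. B < slope q"
    using finite_lower_bound_real[OF assms(1)] by blast
  then have B: "B < slope q" if "q \<in> P" for q
    using that by blast
  \<comment> \<open>The key \<open>B\<close> puts \<open>p\<close> before all other points, so
    \<open>p\<close> can only be the first point of an increasing triple.\<close>
  define g where "g q = (if q = p then B else slope q)" for q
  have nz: "orient p a b \<noteq> 0" if "a \<in> P" "b \<in> P" "a \<noteq> p" "b \<noteq> p" "a \<noteq> b" for a b
  proof -
    have "\<not> collinear {p, a, b}"
      using assms(3) p that by (simp add: general_position_def)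
    then show ?thesis
      using collinear_if_orient_eq_0 by blast
  qed
  show ?thesis
  proof (intro exI[of _ g] conjI ballI impI)
    show "inj_on g P"
    proof (rule inj_onI, rule ccontr)
      fix a b assume ab: "a \<in> P" "b \<in> P" "g a = g b" "a \<noteq> b"
      then have ne: "a \<noteq> p" "b \<noteq> p"
        using B[of a] B[of b] by (auto simp: g_def split: if_splits)
      then have "orient p a b \<noteq> 0"
        using nz ab by blast
      then have "slope a < slope b \<or> slope b < slope a"
        using slope_less[of a b] slope_less[of b a] ne ab(1,2) orient_swap[of p a b] by linarith
      then show False
        using ab(3) ne by (auto simp: g_def)
    qed
  next
    fix a b c assume abc: "a \<in> P" "b \<in> P" "c \<in> P" "g a < g b" "g b < g c"
    have "b \<noteq> p" "c \<noteq> p"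
      using abc B[of a] B[of b] by (auto simp: g_def split: if_splits)
    then have bc: "orient p b c > 0"
      using abc slope_less[of b c] by (auto simp: g_def)
    show "orient a b c > 0"
    proof (cases "a = p")
      case False
      then have "orient p a b > 0" "orient p a c > 0"
        using abc slope_less[of a b] slope_less[of a c] \<open>b \<noteq> p\<close> \<open>c \<noteq> p\<close>
        by (simp_all add: g_def)
      then show ?thesis
        using bc abc p orient_triple_pos[OF assms(2,3), of p a b c] by simp
    qed (use bc in simp)
  qed
qed

lemma ccw_enumeration:
  assumes "finite P" "convex_position P" "general_position P"
  obtains v :: "nat \<Rightarrow> point"
  where "bij_betw v {..<card P} P"
    and "\<And>i j k. \<lbrakk>i < j; j < k; k < card P\<rbrakk> \<Longrightarrow> orient (v i) (v j) (v k) > 0"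
proof -
  obtain g :: "point \<Rightarrow> real" where g: "inj_on g P"
      "\<forall>a\<in>P. \<forall>b\<in>P. \<forall>c\<in>P. g a < g b \<longrightarrow> g b < g c \<longrightarrow> orient a b c > 0"
    using ccw_key[OF assms] by blast
  define h where "h = (!) (sorted_list_of_set (g ` P))"
  have card: "card (g ` P) = card P"
    by (rule card_image[OF g(1)])
  have h: "bij_betw h {..<card P} (g ` P)"
    unfolding h_def using assms(1) card by (intro bij_betw_nth) auto
  have h_mono: "h i < h j" if "i < j" "j < card P" for i j
    using sorted_wrt_nth_less[OF strict_sorted_list_of_set, of i j "g ` P"] that card
    by (simp add: h_def)
  define v where "v = inv_into P g \<circ> h"
  have bij: "bij_betw v {..<card P} P"
    unfolding v_def
  proof (rule bij_betw_trans)
    show "bij_betw h {..<card P} (g ` P)"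
      by (rule h)
    show "bij_betw (inv_into P g) (g ` P) P"
      by (rule bij_betw_inv_into[OF inj_on_imp_bij_betw[OF g(1)]])
  qed
  have gv: "g (v i) = h i" if "i < card P" for i
  proof -
    have "h i \<in> g ` P"
      using bij_betw_apply[OF h] that by simp
    then show ?thesis
      by (simp add: v_def f_inv_into_f)
  qed
  have vP: "v i \<in> P" if "i < card P" for i
    using bij_betw_apply[OF bij] that by simp
  show ?thesis
  proof
    fix i j k assume ijk: "i < j" "j < k" "k < card P"
    then have "h i < h j" "h j < h k"
      using h_mono by simp_all
    then show "orient (v i) (v j) (v k) > 0"
      using ijk g(2) by (simp add: gv vP)
  qed (rule bij)
qed

section \<open>Chords as index pairs, and when two of them cross\<close>

definition chords :: "nat set \<Rightarrow> (nat \<times> nat) set" where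
  "chords S = {(i, j). i \<in> S \<and> j \<in> S \<and> i < j}"

text \<open>Directed: the first chord is the one that starts first. Crossing is the symmetric
  closure, and at most one of the two directions holds.\<close>

definition interleave :: "nat \<times> nat \<Rightarrow> nat \<times> nat \<Rightarrow> bool" where
  "interleave e f \<longleftrightarrow> fst e < fst f \<and> fst f < snd e \<and> snd e < snd f"

text \<open>The signs assumed here, with injectivity to pass between points and indices, decide all
  crossings between edges.\<close>

locale ccw_polygon =
  fixes v :: "nat \<Rightarrow> point" and n :: nat
  assumes inj_v: "inj_on v {..<n}"
    and ccw: "\<lbrakk>i < j; j < k; k < n\<rbrakk> \<Longrightarrow> orient (v i) (v j) (v k) > 0"
begin

definition draw :: "nat \<times> nat \<Rightarrow> point set" where
  "draw e = {v (fst e), v (snd e)}"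

lemma v_eq_iff [simp]: "\<lbrakk>i < n; j < n\<rbrakk> \<Longrightarrow> v i = v j \<longleftrightarrow> i = j"
  using inj_v by (auto simp: inj_on_def)

lemma inj_draw: "inj_on draw (chords {..<n})"
  by (auto simp: inj_on_def draw_def chords_def doubleton_eq_iff)

lemma draw_image_chords: "draw ` chords {..<n} = {e. e \<subseteq> v ` {..<n} \<and> card e = 2}"
proof (intro equalityI subsetI)
  fix e assume "e \<in> draw ` chords {..<n}"
  then show "e \<in> {e. e \<subseteq> v ` {..<n} \<and> card e = 2}"
    by (auto simp: draw_def chords_def)
next
  fix e assume "e \<in> {e. e \<subseteq> v ` {..<n} \<and> card e = 2}"
  then obtain x y where xy: "e = {x, y}" "x \<noteq> y" "e \<subseteq> v ` {..<n}"
    by (auto simp: card_2_iff)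
  then obtain i j where ij: "x = v i" "y = v j" "i < n" "j < n"
    by auto
  then have "e = draw (min i j, max i j)" "(min i j, max i j) \<in> chords {..<n}"
    using xy by (auto simp: draw_def chords_def min_def max_def)
  then show "e \<in> draw ` chords {..<n}"
    by blast
qed

lemma crosses_if_interleave:
  assumes "e \<in> chords {..<n}" "f \<in> chords {..<n}" "interleave e f"
  shows "crosses (draw e) (draw f)"
  using assms unfolding draw_def
  by (intro crosses_if_alternating ccw) (auto simp: interleave_def chords_def)

text \<open>With \<open>orient_pos_outside\<close> this says that a chord separates the vertices
  strictly between its ends from the remaining ones.\<close>

lemma orient_neg_between:
  assumes "i < m" "m < j" "j < n"
  shows "orient (v i) (v j) (v m) < 0"
  using ccw[OF assms] orient_swap[of "v i" "v j" "v m"] by simp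

lemma orient_pos_outside:
  assumes "i < j" "j < n" "m < i \<or> j < m" "m < n"
  shows "orient (v i) (v j) (v m) > 0"
  using assms ccw[of m i j] ccw[of i j m] orient_rotate[of "v i" "v j" "v m"] by auto

text \<open>If the chords do not interleave, both ends of \<open>f\<close> lie on the same closed
  arc cut off by \<open>e\<close>, hence on the same closed side of \<open>e\<close>; as
  \<open>e \<noteq> f\<close>, some end of \<open>f\<close> lies off the line.\<close>

lemma interleave_if_crosses:
  assumes "e \<in> chords {..<n}" "f \<in> chords {..<n}" "crosses (draw e) (draw f)"
  shows "interleave e f \<or> interleave f e"
proof (rule ccontr)
  assume not: "\<not> (interleave e f \<or> interleave f e)"
  obtain i j p q where e: "e = (i, j)" and f: "f = (p, q)"
    by (cases e, cases f)
  have ij: "i < j" "j < n" and pq: "p < q" "q < n"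
    using assms by (auto simp: e f chords_def)
  have ne: "e \<noteq> f"
    using assms(3) by (auto simp: crosses_def)
  let ?o = "\<lambda>m. orient (v i) (v j) (v m)"
  \<comment> \<open>Either both ends of \<open>f\<close> lie on the arc from \<open>i\<close> to
    \<open>j\<close>, or both lie on the complementary arc; the arcs share the ends \<open>i\<close>
    and \<open>j\<close>.\<close>
  consider "i \<le> p" "q \<le> j" | "p \<le> i \<or> j \<le> p" "q \<le> i \<or> j \<le> q"
    using not ij pq by (force simp: interleave_def e f)
  then have "?o p * ?o q \<ge> 0 \<and> (?o p \<noteq> 0 \<or> ?o q \<noteq> 0)"
  proof cases
    case 1
    then have "?o p \<le> 0" "?o q \<le> 0"
      using orient_neg_between[of i p j] orient_neg_between[of i q j] ij pq
      by (force simp: le_less)+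
    moreover have "?o p < 0 \<or> ?o q < 0"
      using orient_neg_between[of i p j] orient_neg_between[of i q j] ij pq 1 ne
      by (force simp: e f)
    ultimately show ?thesis
      by (auto intro: mult_nonpos_nonpos)
  next
    case 2
    then have "?o p \<ge> 0" "?o q \<ge> 0"
      using orient_pos_outside[of i j p] orient_pos_outside[of i j q] ij pq
      by (force simp: le_less)+
    moreover have "?o p > 0 \<or> ?o q > 0"
      using orient_pos_outside[of i j p] orient_pos_outside[of i j q] ij pq 2 ne
      by (force simp: e f)
    ultimately show ?thesis
      by auto
  qed
  then have "\<not> crosses (draw e) (draw f)"
    unfolding draw_def e f fst_conv snd_conv
    using ij pq by (intro not_crosses_if_same_side) auto
  with assms(3) show False
    by simp
qed

lemma crosses_iff_interleave:
  assumes "e \<in> chords {..<n}" "f \<in> chords {..<n}"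
  shows "crosses (draw e) (draw f) \<longleftrightarrow> interleave e f \<or> interleave f e"
proof -
  have "crosses (draw f) (draw e) \<longleftrightarrow> crosses (draw e) (draw f)"
    by (auto simp: crosses_def)
  then show ?thesis
    using assms crosses_if_interleave interleave_if_crosses by blast
qed

end

section \<open>Groups of parallel classes\<close>

lemma mod_twice: "(x::nat) < 2 * n \<Longrightarrow> x mod n = (if x < n then x else x - n)"
  by (auto simp: mod_if)

text \<open>The displacements \<open>(a, b)\<close> of the two end points that are possible for a
  crossing chord at most \<open>r\<close> classes away.\<close>

definition triangle :: "nat \<Rightarrow> (nat \<times> nat) set" where
  "triangle r = {(a, b). 1 \<le> a \<and> 1 \<le> b \<and> a + b \<le> r}"

lemma finite_triangle: "finite (triangle r)"
  by (rule finite_subset[of _ "{..r} \<times> {..r}"]) (auto simp: triangle_def)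

lemma card_triangle: "2 * card (triangle r) = r * (r - 1)"
proof (induction r)
  case 0
  have "triangle 0 = {}"
    by (auto simp: triangle_def)
  then show ?case
    by simp
next
  case (Suc r)
  \<comment> \<open>The new pairs form the antidiagonal \<open>a + b = r + 1\<close>, which has
    \<open>r\<close> elements.\<close>
  have "triangle (Suc r) = triangle r \<union> (\<lambda>a. (a, Suc r - a)) ` {1..r}"
    by (auto simp: triangle_def image_iff)
  moreover have "triangle r \<inter> (\<lambda>a. (a, Suc r - a)) ` {1..r} = {}"
    by (auto simp: triangle_def)
  moreover have "card ((\<lambda>a. (a, Suc r - a)) ` {1..r}) = r"
    by (subst card_image) (auto simp: inj_on_def)
  ultimately have "card (triangle (Suc r)) = card (triangle r) + r"
    by (simp add: card_Un_disjoint finite_triangle)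
  then show ?case
    using Suc by (cases r) auto
qed

text \<open>
  Write the inner end point of the crossing chord as \<open>i + a\<close> and the outer one, cyclically, as
  \<open>j + b\<close>. If the class number grows without wrapping around, it grows by \<open>a + b\<close>; otherwise
  measure the end points from the other side, as \<open>j - a\<close> and \<open>i - b\<close>.
\<close>

lemma interleave_class_cases:
  assumes ij: "i < j" "j < n" and pq: "p < q" "q < n"
    and "interleave (i, j) (p, q) \<or> interleave (p, q) (i, j)"
  shows "\<exists>a b. 1 \<le> a \<and> 1 \<le> b \<and>
    ((p + q) mod n = (i + j) mod n + a + b \<and> {p, q} = {i + a, (j + b) mod n} \<or>
     (i + j) mod n = (p + q) mod n + a + b \<and> {p, q} = {j - a, (i + n - b) mod n})"
proof -
  have c: "(i + j) mod n = (if i + j < n then i + j else i + j - n)"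
    "(p + q) mod n = (if p + q < n then p + q else p + q - n)"
    using ij pq by (simp_all add: mod_twice)
  consider (A) "i < p" "p < j" "j < q" | (B) "p < i" "i < q" "q < j"
    using assms(5) by (auto simp: interleave_def)
  then show ?thesis
  proof cases
    case A
    \<comment> \<open>The sum of the displacements \<open>p - i\<close> and \<open>q - j\<close>
      lies strictly between 0 and \<open>n\<close>. The class therefore either rises by this sum or
      falls by \<open>n\<close> minus this sum, and the latter is
      \<open>(j - p) + (n + i - q)\<close>.\<close>
    consider "(p + q) mod n = (i + j) mod n + (p - i) + (q - j)"
      | "(i + j) mod n = (p + q) mod n + (j - p) + (n + i - q)"
      unfolding c using A ij pq by (cases "i + j < n"; cases "p + q < n"; simp; linarith)
    then show ?thesis
    proof cases
      case 1
      moreover have "{p, q} = {i + (p - i), (j + (q - j)) mod n}"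
        using A pq by simp
      ultimately show ?thesis
        using A
        by (intro exI[of _ "p - i"] exI[of _ "q - j"] conjI disjI1; (assumption | linarith))
    next
      case 2
      moreover have "{p, q} = {j - (j - p), (i + n - (n + i - q)) mod n}"
        using A pq by simp
      ultimately show ?thesis
        using A pq
        by (intro exI[of _ "j - p"] exI[of _ "n + i - q"] conjI disjI2; (assumption | linarith))
    qed
  next
    case B
    \<comment> \<open>Here \<open>p\<close> lies before \<open>i\<close>, so it is reached from
      \<open>j\<close> by going past index 0; hence the cyclic distance
      \<open>p + n - j\<close>.\<close>
    consider "(p + q) mod n = (i + j) mod n + (q - i) + (p + n - j)"
      | "(i + j) mod n = (p + q) mod n + (j - q) + (i - p)"
      unfolding c using B ij pq by (cases "i + j < n"; cases "p + q < n"; simp; linarith)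
    then show ?thesis
    proof cases
      case 1
      moreover have "{p, q} = {i + (q - i), (j + (p + n - j)) mod n}"
        using B ij pq by (simp add: insert_commute)
      ultimately show ?thesis
        using B ij
        by (intro exI[of _ "q - i"] exI[of _ "p + n - j"] conjI disjI1; (assumption | linarith))
    next
      case 2
      moreover have "{p, q} = {j - (j - q), (i + n - (i - p)) mod n}"
        using B ij pq by (simp add: insert_commute)
      ultimately show ?thesis
        using B
        by (intro exI[of _ "j - q"] exI[of _ "i - p"] conjI disjI2; (assumption | linarith))
    qed
  qed
qed

text \<open>Within its block of \<open>s\<close> consecutive numbers, \<open>c\<close> has
  \<open>c mod s\<close> predecessors and \<open>s - 1 - c mod s\<close> successors.\<close>

lemma same_div_diff_le:
  fixes c c' s :: nat
  assumes "c div s = c' div s" "s > 0"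
  shows "c' \<le> c + (s - 1 - c mod s)" "c \<le> c' + c mod s"
proof -
  have c: "c = c div s * s + c mod s" and c': "c' = c div s * s + c' mod s"
    using assms(1) by (metis div_mult_mod_eq)+
  moreover have "c' mod s < s"
    using assms(2) by simp
  ultimately show "c' \<le> c + (s - 1 - c mod s)" "c \<le> c' + c mod s"
    by linarith+
qed

text \<open>The doubled sides differ by \<open>2 * r * t\<close>, so splitting the available classes
  into those before and those after costs nothing.\<close>

lemma triangle_sum_le:
  assumes "r + t = m"
  shows "card (triangle r) + card (triangle t) \<le> m * (m - 1) div 2"
proof -
  have "r * (r - 1) + t * (t - 1) \<le> m * (m - 1)"
    using assms by (cases r; cases t) (auto simp: algebra_simps)
  then show ?thesis
    using card_triangle[of r] card_triangle[of t] by linarith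
qed

lemma less_ceiling_div:
  fixes c m s :: nat
  assumes "c < m" "s > 0"
  shows "c div s < nat \<lceil>real m / real s\<rceil>"
proof -
  have "real (c div s * s) \<le> real c"
    by (simp only: of_nat_le_iff div_times_less_eq_dividend)
  then have "real (c div s) \<le> real c / real s"
    using assms(2) by (simp add: le_divide_eq)
  also have "\<dots> < real m / real s"
    using assms by (simp add: divide_strict_right_mono)
  finally have "int (c div s) < \<lceil>real m / real s\<rceil>"
    by (simp add: less_ceiling_iff)
  then show ?thesis
    by linarith
qed

text \<open>Every group contains its first class \<open>g * s\<close>. This makes the number of
  groups exact instead of an upper bound.\<close>

lemma group_start_less:
  fixes g m s :: nat
  assumes "g < nat \<lceil>real m / real s\<rceil>" "s > 0"
  shows "g * s < m"
proof -
  have "int g < \<lceil>real m / real s\<rceil>"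
    using assms(1) by linarith
  then have "real g * real s < real m"
    using assms(2) by (simp add: less_ceiling_iff field_simps)
  then show ?thesis
    by (metis of_nat_less_iff of_nat_mult)
qed

section \<open>The groups as geometric graphs partitioning the complete graph\<close>

context ccw_polygon
begin

text \<open>In a regular \<open>n\<close>-gon, chords with the same \<open>(i + j) mod n\<close> are
  parallel; a group thus collects the chords of up to \<open>s\<close> consecutive
  directions.\<close>

definition group_chords :: "nat \<Rightarrow> nat \<Rightarrow> (nat \<times> nat) set" where
  "group_chords s g = {e \<in> chords {..<n}. (fst e + snd e) mod n div s = g}"

definition group_graph :: "nat \<Rightarrow> nat \<Rightarrow> geo_graph" where
  "group_graph s g = \<lparr>verts = v ` {..<n}, edges = draw ` group_chords s g\<rparr>"

lemma geometric_group_graph: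
  "general_position (v ` {..<n}) \<Longrightarrow> geometric_graph (group_graph s g)"
  using draw_image_chords by (auto simp: geometric_graph_def group_graph_def group_chords_def)

text \<open>The group has at most \<open>t\<close> classes before that of \<open>e\<close> and
  \<open>r\<close> after it, with \<open>r + t = s - 1\<close>. A crossing chord is recovered from
  its displacements, which lie in \<open>triangle r\<close> or \<open>triangle t\<close>.
  Displacements are at least 1, so no crossing occurs inside a class.\<close>

lemma card_group_crossings:
  assumes "e \<in> group_chords s g" "s > 0"
  shows "card {f \<in> draw ` group_chords s g. crosses (draw e) f} \<le> (s - 1) * (s - 2) div 2"
proof -
  obtain i j where e: "e = (i, j)"
    by (cases e)
  have ij: "i < j" "j < n" and g: "(i + j) mod n div s = g"
    using assms(1) by (auto simp: e group_chords_def chords_def)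
  define t where "t = (i + j) mod n mod s"
  define r where "r = s - 1 - t"
  have rt: "r + t = s - 1"
    using mod_less_divisor[OF assms(2), of "(i + j) mod n"] by (simp add: r_def t_def)
  \<comment> \<open>\<open>F\<close> and \<open>F'\<close> rebuild an edge from its displacements
    for a later and an earlier class. They only have to cover the crossing edges, so values that are
    no edges of the group do no harm.\<close>
  define F where "F = (\<lambda>(a, b). {v (i + a), v ((j + b) mod n)})"
  define F' where "F' = (\<lambda>(a, b). {v (j - a), v ((i + n - b) mod n)})"
  have "{f \<in> draw ` group_chords s g. crosses (draw e) f} \<subseteq> F ` triangle r \<union> F' ` triangle t"
  proof (clarify, rule ccontr)
    fix p q assume pq: "(p, q) \<in> group_chords s g" "crosses (draw e) (draw (p, q))"
      and not: "draw (p, q) \<notin> F' ` triangle t" "draw (p, q) \<notin> F ` triangle r"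
    have pq': "p < q" "q < n" and g': "(p + q) mod n div s = g"
      using pq(1) by (auto simp: group_chords_def chords_def)
    have "interleave (i, j) (p, q) \<or> interleave (p, q) (i, j)"
      using interleave_if_crosses[OF _ _ pq(2)] assms(1) pq(1) by (simp add: e group_chords_def)
    then obtain a b where ab: "1 \<le> a" "1 \<le> b"
      and "(p + q) mod n = (i + j) mod n + a + b \<and> {p, q} = {i + a, (j + b) mod n} \<or>
        (i + j) mod n = (p + q) mod n + a + b \<and> {p, q} = {j - a, (i + n - b) mod n}"
      using interleave_class_cases[OF ij pq'] by blast
    then show False
    proof (elim disjE conjE)
      assume "(p + q) mod n = (i + j) mod n + a + b" and eq: "{p, q} = {i + a, (j + b) mod n}"
      then have "a + b \<le> r"
        using same_div_diff_le(1)[of "(i + j) mod n" s "(p + q) mod n"] g g' assms(2)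
        by (simp add: r_def t_def)
      then have "(a, b) \<in> triangle r"
        using ab by (simp add: triangle_def)
      moreover have "draw (p, q) = F (a, b)"
        using arg_cong[OF eq, of "image v"] by (simp add: draw_def F_def)
      ultimately show False
        using not by blast
    next
      assume "(i + j) mod n = (p + q) mod n + a + b" and eq: "{p, q} = {j - a, (i + n - b) mod n}"
      then have "a + b \<le> t"
        using same_div_diff_le(2)[of "(i + j) mod n" s "(p + q) mod n"] g g' assms(2)
        by (simp add: t_def)
      then have "(a, b) \<in> triangle t"
        using ab by (simp add: triangle_def)
      moreover have "draw (p, q) = F' (a, b)"
        using arg_cong[OF eq, of "image v"] by (simp add: draw_def F'_def)
      ultimately show False
        using not by blast
    qed
  qed
  then have "card {f \<in> draw ` group_chords s g. crosses (draw e) f}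
      \<le> card (F ` triangle r \<union> F' ` triangle t)"
    by (intro card_mono) (auto simp: finite_triangle)
  also have "\<dots> \<le> card (triangle r) + card (triangle t)"
    by (intro order_trans[OF card_Un_le] add_mono card_image_le finite_triangle)
  also have "\<dots> \<le> (s - 1) * (s - 1 - 1) div 2"
    by (rule triangle_sum_le[OF rt])
  finally show ?thesis
    by (simp add: numeral_2_eq_2)
qed

lemma group_graph_k_planar:
  assumes "general_position (v ` {..<n})" "s > 0"
  shows "k_planar ((s - 1) * (s - 2) div 2) (group_graph s g)"
  using geometric_group_graph[OF assms(1)] card_group_crossings[OF _ assms(2)]
  by (auto simp: k_planar_def group_graph_def)

lemma inj_group_graph:
  assumes "s > 0"
  shows "inj_on (group_graph s) {..<nat \<lceil>real n / real s\<rceil>}"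
proof (rule linorder_inj_onI)
  fix g h assume gh: "g < h" "g \<in> {..<nat \<lceil>real n / real s\<rceil>}" "h \<in> {..<nat \<lceil>real n / real s\<rceil>}"
  have "h * s < n" "0 < h * s"
    using group_start_less[of h n s] gh assms by auto
  then have e: "(0, h * s) \<in> chords {..<n}" "(0 + h * s) mod n div s = h"
    using assms by (auto simp: chords_def)
  then have "draw (0, h * s) \<in> edges (group_graph s h)"
    by (auto simp: group_graph_def group_chords_def)
  moreover have "draw (0, h * s) \<notin> edges (group_graph s g)"
  proof
    assume "draw (0, h * s) \<in> edges (group_graph s g)"
    then have "(0, h * s) \<in> group_chords s g"
      using inj_on_image_mem_iff[OF inj_draw e(1), of "group_chords s g"]
      by (auto simp: group_graph_def group_chords_def)
    then show False
      using e gh by (simp add: group_chords_def)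
  qed
  ultimately show "group_graph s g \<noteq> group_graph s h"
    by metis
qed auto

lemma group_graph_partition:
  assumes "general_position (v ` {..<n})" "s > 0"
  shows "graph_partition (group_graph s ` {..<nat \<lceil>real n / real s\<rceil>})
    (complete_geometric_graph (v ` {..<n}))"
proof -
  let ?N = "nat \<lceil>real n / real s\<rceil>"
  have "(\<Union>g<?N. group_chords s g) = chords {..<n}"
  proof (intro equalityI subsetI)
    fix e assume e: "e \<in> chords {..<n}"
    then have "(fst e + snd e) mod n < n"
      by (auto simp: chords_def)
    then have "(fst e + snd e) mod n div s < ?N"
      by (rule less_ceiling_div[OF _ assms(2)])
    then show "e \<in> (\<Union>g<?N. group_chords s g)"
      using e by (auto simp: group_chords_def)
  qed (auto simp: group_chords_def)
  then have edges: "(\<Union>g<?N. draw ` group_chords s g) = draw ` chords {..<n}"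
    by (metis image_UN)
  have disj: "draw ` group_chords s g \<inter> draw ` group_chords s h = {}" if "g \<noteq> h" for g h
  proof -
    have "group_chords s g \<inter> group_chords s h = {}"
      using that by (auto simp: group_chords_def)
    then show ?thesis
      using inj_on_image_Int[OF inj_draw, of "group_chords s g" "group_chords s h"]
      by (auto simp: group_chords_def)
  qed
  \<comment> \<open>For \<open>n = 0\<close> there are no groups and no vertices; otherwise at least
    one group exists and carries all vertices.\<close>
  have verts: "(\<Union>g<?N. v ` {..<n}) = v ` {..<n}"
  proof (cases "n = 0")
    case False
    then have "0 < ?N"
      using less_ceiling_div[of 0 n s] assms(2) by simp
    then have "{..<?N} \<noteq> {}"
      by blast
    then show ?thesis
      by simp
  qed simp
  show ?thesis
    unfolding graph_partition_def
  proof (intro conjI ballI impI)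
    fix H assume "H \<in> group_graph s ` {..<?N}"
    then obtain g where H: "H = group_graph s g"
      by blast
    have "edges H \<subseteq> draw ` chords {..<n}" "verts H = v ` {..<n}"
      by (auto simp: H group_graph_def group_chords_def)
    then show "subgraph H (complete_geometric_graph (v ` {..<n}))"
      using geometric_group_graph[OF assms(1), of s g] draw_image_chords
      by (simp add: subgraph_def complete_geometric_graph_def H)
  next
    fix H H' assume "H \<in> group_graph s ` {..<?N}" "H' \<in> group_graph s ` {..<?N}" "H \<noteq> H'"
    then obtain g h where "H = group_graph s g" "H' = group_graph s h" "g \<noteq> h"
      by blast
    then show "edges H \<inter> edges H' = {}"
      using disj by (simp add: group_graph_def)
  next
    show "(\<Union>H\<in>group_graph s ` {..<?N}. verts H) = verts (complete_geometric_graph (v ` {..<n}))"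
      using verts by (simp add: group_graph_def complete_geometric_graph_def)
    show "(\<Union>H\<in>group_graph s ` {..<?N}. edges H) = edges (complete_geometric_graph (v ` {..<n}))"
      using edges draw_image_chords by (simp add: group_graph_def complete_geometric_graph_def)
  qed
qed

lemma partition_into_groups:
  assumes "general_position (v ` {..<n})" "s > 0"
  shows "\<exists>\<H>. graph_partition \<H> (complete_geometric_graph (v ` {..<n})) \<and>
    (\<forall>H\<in>\<H>. k_planar ((s - 1) * (s - 2) div 2) H) \<and> int (card \<H>) = \<lceil>real n / real s\<rceil>"
proof (intro exI conjI)
  have "0 \<le> \<lceil>real n / real s\<rceil>"
    by (simp add: order_less_le_trans[of "-1" 0])
  then show "int (card (group_graph s ` {..<nat \<lceil>real n / real s\<rceil>})) = \<lceil>real n / real s\<rceil>"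
    using card_image[OF inj_group_graph[OF assms(2)]] by simp
qed (use group_graph_partition[OF assms] group_graph_k_planar[OF assms] in auto)

end

section \<open>Counting crossings of chords\<close>

text \<open>
  If a triangulation contains \<open>D\<close>, then the triangle below the chord \<open>(i, j)\<close> has a third vertex
  strictly between \<open>i\<close> and \<open>j\<close>, and it determines the chord. The vertex chosen below
  plays this role without an actual triangulation.
\<close>

lemma card_noncrossing_le:
  assumes "finite S" "D \<subseteq> chords S"
    and between: "\<And>i j. (i, j) \<in> D \<Longrightarrow> \<exists>m\<in>S. i < m \<and> m < j"
    and noncrossing: "\<And>e f. e \<in> D \<Longrightarrow> f \<in> D \<Longrightarrow> \<not> interleave e f"
  shows "card D \<le> card S - 2"
proof (cases "D = {}")
  case False
  \<comment> \<open>The third vertex \<open>m\<close> for \<open>e\<close> is the farthest neighbour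
    of \<open>fst e\<close> in \<open>D\<close> below \<open>snd e\<close>, or the successor of
    \<open>fst e\<close> in \<open>S\<close> if there is no such neighbour.\<close>
  let ?Q = "\<lambda>e m. m \<in> S \<and> fst e < m \<and> m < snd e \<and>
    (\<forall>y. (fst e, y) \<in> D \<longrightarrow> y < snd e \<longrightarrow> y \<le> m) \<and>
    ((fst e, m) \<in> D \<or> (\<forall>x\<in>S. fst e < x \<longrightarrow> m \<le> x))"
  have "\<exists>m. ?Q e m" if e: "e \<in> D" for e
  proof -
    define A where "A = {m \<in> S. fst e < m \<and> m < snd e \<and> (fst e, m) \<in> D}"
    have fin: "finite A"
      using assms(1) by (simp add: A_def)
    have A: "y \<in> A" if "(fst e, y) \<in> D" "y < snd e" for y
      using that assms(2) by (auto simp: A_def chords_def)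
    show ?thesis
    proof (cases "A = {}")
      case True
      define B where "B = {m \<in> S. fst e < m}"
      obtain m where m: "m \<in> S" "fst e < m" "m < snd e"
        using between[of "fst e" "snd e"] e by auto
      have B: "finite B" "m \<in> B"
        using assms(1) m by (auto simp: B_def)
      have "Min B \<in> B" "Min B \<le> m" "\<forall>x\<in>B. Min B \<le> x"
        using B Min_in[OF B(1)] Min_le[OF B(1)] by blast+
      then show ?thesis
        using A True m by (intro exI[of _ "Min B"]) (auto simp: B_def)
    next
      case False
      then have "Max A \<in> A" "\<forall>x\<in>A. x \<le> Max A"
        using fin by auto
      then show ?thesis
        using A by (intro exI[of _ "Max A"]) (auto simp: A_def)
    qed
  qed
  then obtain \<phi> where \<phi>: "\<And>e. e \<in> D \<Longrightarrow> ?Q e (\<phi> e)"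
    by metis
  have "inj_on \<phi> D"
  proof (rule inj_onI, rule ccontr)
    \<comment> \<open>Since \<open>fst f\<close> lies before the common third vertex, that vertex is
      not the successor of \<open>fst e\<close>. So it is joined to \<open>fst e\<close> in
      \<open>D\<close>, by a chord that crosses \<open>f\<close>.\<close>
    have *: False if "e \<in> D" "f \<in> D" "\<phi> e = \<phi> f" "fst e < fst f" for e f
    proof -
      have "fst f \<in> S" "fst f < \<phi> e" "\<phi> e < snd f"
        using that \<phi>[of f] assms(2) by (auto simp: chords_def)
      then have "(fst e, \<phi> e) \<in> D"
        using \<phi>[of e] that by force
      moreover have "interleave (fst e, \<phi> e) f"
        using that \<open>fst f < \<phi> e\<close> \<open>\<phi> e < snd f\<close> by (simp add: interleave_def)
      ultimately show False
        using noncrossing that by blast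
    qed
    \<comment> \<open>The end of the shorter chord \<open>f\<close> competes for the third vertex of
      \<open>e\<close>, which is then at least \<open>snd f\<close>, while that of \<open>f\<close>
      lies below \<open>snd f\<close>.\<close>
    have **: False if "e \<in> D" "f \<in> D" "\<phi> e = \<phi> f" "fst e = fst f" "snd f < snd e" for e f
    proof -
      have "snd f \<le> \<phi> e"
        using \<phi>[of e] that by (metis prod.collapse)
      then show False
        using \<phi>[of f] that by simp
    qed
    fix e f assume "e \<in> D" "f \<in> D" "\<phi> e = \<phi> f" "e \<noteq> f"
    then show False
      using *[of e f] *[of f e] **[of e f] **[of f e] by (metis linorder_neqE_nat prod_eqI)
  qed
  \<comment> \<open>Third vertices lie strictly inside their chords, so the extremes of
    \<open>S\<close> are missed; this is the 2 in the bound.\<close>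
  moreover have "\<phi> ` D \<subseteq> S - {Min S, Max S}"
  proof clarify
    fix i j assume e: "(i, j) \<in> D"
    then have "i \<in> S" "j \<in> S"
      using assms(2) by (auto simp: chords_def)
    then show "\<phi> (i, j) \<in> S - {Min S, Max S}"
      using \<phi>[OF e] Min_le[OF assms(1), of i] Max_ge[OF assms(1), of j] by auto
  qed
  ultimately have "card D \<le> card (S - {Min S, Max S})"
    using assms(1) by (intro card_inj_on_le) auto
  moreover have "card {Min S, Max S} = 2 \<and> {Min S, Max S} \<subseteq> S"
  proof -
    obtain i j where e: "(i, j) \<in> D"
      using False by auto
    then have ij: "i \<in> S" "j \<in> S" "i < j"
      using assms(2) by (auto simp: chords_def)
    then have ne: "S \<noteq> {}"
      by blast
    have "Min S < Max S"
      using Min_le[OF assms(1) ij(1)] Max_ge[OF assms(1) ij(2)] ij(3) by linarith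
    moreover have "Min S \<in> S" "Max S \<in> S"
      using assms(1) ne by simp_all
    ultimately show ?thesis
      by auto
  qed
  ultimately show ?thesis
    using assms(1) by (simp add: card_Diff_subset)
qed simp

section \<open>Chords and diagonals of the polygon on a vertex subset\<close>

lemma finite_chords: "finite S \<Longrightarrow> finite (chords S)"
  by (rule finite_subset[of _ "S \<times> S"]) (auto simp: chords_def)

lemma card_chords:
  assumes "finite S"
  shows "card (chords S) = card S choose 2"
proof -
  have inj: "inj_on (\<lambda>(i, j). {i, j}) (chords S)"
    by (auto simp: inj_on_def chords_def doubleton_eq_iff)
  have img: "(\<lambda>(i, j). {i, j}) ` chords S = {K. K \<subseteq> S \<and> card K = 2}"
  proof (intro equalityI subsetI)
    fix K assume "K \<in> {K. K \<subseteq> S \<and> card K = 2}"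
    then obtain x y where xy: "K = {x, y}" "x \<noteq> y" "x \<in> S" "y \<in> S"
      by (auto simp: card_2_iff)
    then have "K = (\<lambda>(i, j). {i, j}) (min x y, max x y)" "(min x y, max x y) \<in> chords S"
      by (auto simp: chords_def min_def max_def)
    then show "K \<in> (\<lambda>(i, j). {i, j}) ` chords S"
      by blast
  qed (auto simp: chords_def)
  show ?thesis
    using card_image[OF inj] by (simp add: img n_subsets[OF assms])
qed

text \<open>What is left out are the sides of the polygon on \<open>S\<close>: pairs of neighbours
  and the closing side. No chord of \<open>S\<close> crosses a side.\<close>

definition diagonals :: "nat set \<Rightarrow> (nat \<times> nat) set" where
  "diagonals S = {(i, j) \<in> chords S. (\<exists>m\<in>S. i < m \<and> m < j) \<and> (i, j) \<noteq> (Min S, Max S)}"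

text \<open>The closing side crosses no chord of \<open>S\<close> and still has a vertex between its
  ends. Adding it to \<open>D\<close> improves the bound of \<open>card_noncrossing_le\<close> by
  one.\<close>

lemma card_noncrossing_diagonals_le:
  assumes "finite S" "card S \<ge> 3" "D \<subseteq> diagonals S"
    and noncrossing: "\<And>e f. e \<in> D \<Longrightarrow> f \<in> D \<Longrightarrow> \<not> interleave e f"
  shows "card D \<le> card S - 3"
proof -
  let ?h = "(Min S, Max S)"
  have ne: "S \<noteq> {}"
    using assms(2) by auto
  have bounds: "Min S \<in> S" "Max S \<in> S" "\<And>x. x \<in> S \<Longrightarrow> Min S \<le> x \<and> x \<le> Max S"
    using assms(1) ne by auto
  have "\<not> S \<subseteq> {Min S, Max S}"
  proof
    assume "S \<subseteq> {Min S, Max S}"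
    then have "card S \<le> card {Min S, Max S}"
      by (intro card_mono) auto
    then show False
      using assms(2) by (simp add: card_insert_if split: if_splits)
  qed
  then obtain m where m: "m \<in> S" "m \<noteq> Min S" "m \<noteq> Max S"
    by blast
  then have "Min S < m" "m < Max S"
    using bounds(3)[of m] by auto
  have "card (insert ?h D) \<le> card S - 2"
  proof (rule card_noncrossing_le[OF assms(1)])
    show "insert ?h D \<subseteq> chords S"
      using assms(3) bounds \<open>Min S < m\<close> \<open>m < Max S\<close> by (auto simp: diagonals_def chords_def)
    show "\<exists>m\<in>S. i < m \<and> m < j" if "(i, j) \<in> insert ?h D" for i j
      using that assms(3) m(1) \<open>Min S < m\<close> \<open>m < Max S\<close> by (auto simp: diagonals_def)
    have "\<not> interleave ?h f" "\<not> interleave f ?h" if "f \<in> insert ?h D" for f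
    proof -
      have "fst f \<in> S" "snd f \<in> S"
        using that assms(3) bounds by (auto simp: diagonals_def chords_def)
      then show "\<not> interleave ?h f" "\<not> interleave f ?h"
        using bounds(3)[of "fst f"] bounds(3)[of "snd f"] by (auto simp: interleave_def)
    qed
    then show "\<not> interleave e f" if "e \<in> insert ?h D" "f \<in> insert ?h D" for e f
      using that noncrossing by blast
  qed
  moreover have "?h \<notin> D"
    using assms(3) by (auto simp: diagonals_def)
  moreover have "finite D"
    by (rule finite_subset[OF _ finite_chords[OF assms(1)]]) (use assms(3) in \<open>auto simp: diagonals_def\<close>)
  ultimately show ?thesis
    by simp
qed

text \<open>A side between neighbours is determined by its left end, which is not
  \<open>Max S\<close>. With the closing side this makes at most \<open>card S\<close>
  sides.\<close>

lemma card_diagonals_ge: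
  assumes "finite S" "S \<noteq> {}"
  shows "card S choose 2 \<le> card (diagonals S) + card S"
proof -
  define B where "B = {(i, j) \<in> chords S. \<not> (\<exists>m\<in>S. i < m \<and> m < j)}"
  have "inj_on fst B"
  proof (rule inj_onI)
    fix e f assume "e \<in> B" "f \<in> B" "fst e = fst f"
    then show "e = f"
      by (cases e; cases f) (auto simp: B_def chords_def, metis linorder_neqE_nat)
  qed
  moreover have "fst ` B \<subseteq> S - {Max S}"
  proof clarify
    fix i j assume "(i, j) \<in> B"
    then show "fst (i, j) \<in> S - {Max S}"
      using Max_ge[OF assms(1), of j] by (auto simp: B_def chords_def)
  qed
  ultimately have "card B \<le> card (S - {Max S})"
    using assms(1) by (intro card_inj_on_le) auto
  also have "\<dots> = card S - 1"
    using assms by simp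
  finally have B: "card B \<le> card S - 1" .
  have "finite B" "finite (diagonals S)"
    by (rule finite_subset[OF _ finite_chords[OF assms(1)]], force simp: B_def diagonals_def)+
  have "card S choose 2 = card (chords S)"
    by (simp add: card_chords[OF assms(1)])
  also have "\<dots> \<le> card (diagonals S \<union> insert (Min S, Max S) B)"
    using \<open>finite B\<close> \<open>finite (diagonals S)\<close>
    by (intro card_mono) (auto simp: B_def diagonals_def)
  also have "\<dots> \<le> card (diagonals S) + card (insert (Min S, Max S) B)"
    by (rule card_Un_le)
  also have "card (insert (Min S, Max S) B) \<le> Suc (card B)"
    by (rule card_insert_le_m1) auto
  also have "Suc (card B) \<le> card S"
    using B assms by (simp add: Suc_le_eq card_gt_0_iff less_eq_Suc_le[symmetric] le_less_trans)
  finally show ?thesis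
    by simp
qed

text \<open>Deleting one member of a related pair loses one element and destroys at least one pair;
  repeat until no pair is left.\<close>

lemma independent_subset:
  fixes R :: "'a \<Rightarrow> 'a \<Rightarrow> bool"
  assumes "finite D"
  shows "\<exists>M\<subseteq>D. (\<forall>e\<in>M. \<forall>f\<in>M. \<not> R e f) \<and> card D \<le> card M + card {(e, f) \<in> D \<times> D. R e f}"
  using assms
proof (induction D rule: finite_psubset_induct)
  case (psubset D)
  show ?case
  proof (cases "\<forall>e\<in>D. \<forall>f\<in>D. \<not> R e f")
    case False
    then obtain e f where ef: "e \<in> D" "f \<in> D" "R e f"
      by blast
    let ?X = "\<lambda>D. {(e, f) \<in> D \<times> D. R e f}"
    obtain M where M: "M \<subseteq> D - {e}" "\<forall>e\<in>M. \<forall>f\<in>M. \<not> R e f"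
      "card (D - {e}) \<le> card M + card (?X (D - {e}))"
      using psubset.IH[of "D - {e}"] ef by blast
    have "finite (?X D)"
      by (rule finite_subset[of _ "D \<times> D"]) (use psubset in auto)
    then have "card (?X (D - {e})) < card (?X D)"
      using ef by (intro psubset_card_mono) auto
    moreover have "card D = Suc (card (D - {e}))"
      by (rule card.remove[OF psubset.hyps ef(1)])
    ultimately show ?thesis
      using M by (intro exI[of _ M]) auto
  qed auto
qed

text \<open>As \<open>interleave\<close> is directed, each crossing is recorded once although the
  pairs are ordered.\<close>

definition crossings :: "(nat \<times> nat) set \<Rightarrow> ((nat \<times> nat) \<times> (nat \<times> nat)) set" where
  "crossings D = {(e, f) \<in> D \<times> D. interleave e f}"

definition corners :: "(nat \<times> nat) \<times> (nat \<times> nat) \<Rightarrow> nat set" where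
  "corners = (\<lambda>((i, j), (p, q)). {i, j, p, q})"

lemma finite_crossings: "finite D \<Longrightarrow> finite (crossings D)"
  by (rule finite_subset[of _ "D \<times> D"]) (auto simp: crossings_def)

text \<open>Deleting diagonals until none cross leaves at most \<open>card S - 3\<close>, and each
  deletion is charged to a crossing. The crossings are described by their corners, which is what the
  averaging over \<open>S\<close> needs.\<close>

lemma card_diagonals_le_crossings:
  assumes "finite S" "card S \<ge> 3" "finite D"
  shows "card (D \<inter> diagonals S) \<le> (card S - 3) + card {x \<in> crossings D. corners x \<subseteq> S}"
proof -
  obtain M where M: "M \<subseteq> D \<inter> diagonals S" "\<forall>e\<in>M. \<forall>f\<in>M. \<not> interleave e f"
    "card (D \<inter> diagonals S) \<le> card M + card (crossings (D \<inter> diagonals S))"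
    using independent_subset[of "D \<inter> diagonals S" interleave] assms(3)
    unfolding crossings_def by blast
  have "card M \<le> card S - 3"
    using card_noncrossing_diagonals_le[OF assms(1,2), of M] M(1,2) by blast
  moreover have "card (crossings (D \<inter> diagonals S)) \<le> card {x \<in> crossings D. corners x \<subseteq> S}"
  proof (rule card_mono)
    show "finite {x \<in> crossings D. corners x \<subseteq> S}"
      using finite_crossings[OF assms(3)] by simp
  qed (auto simp: crossings_def corners_def diagonals_def chords_def)
  ultimately show ?thesis
    using M(3) by linarith
qed

section \<open>Averaging over vertex subsets\<close>

text \<open>Removing \<open>B\<close> is a bijection from these supersets to the subsets of
  \<open>A - B\<close> of the remaining size.\<close>

lemma card_supersets:
  assumes "finite A" "B \<subseteq> A" "card B \<le> s"
  shows "card {S. S \<subseteq> A \<and> card S = s \<and> B \<subseteq> S} = (card A - card B) choose (s - card B)"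
proof -
  have finB: "finite B"
    using assms finite_subset by blast
  have "bij_betw (\<lambda>T. T \<union> B) {T. T \<subseteq> A - B \<and> card T = s - card B} {S. S \<subseteq> A \<and> card S = s \<and> B \<subseteq> S}"
  proof (rule bij_betw_byWitness[where f' = "\<lambda>S. S - B"])
    show "(\<lambda>T. T \<union> B) ` {T. T \<subseteq> A - B \<and> card T = s - card B} \<subseteq> {S. S \<subseteq> A \<and> card S = s \<and> B \<subseteq> S}"
    proof clarify
      fix T assume T: "T \<subseteq> A - B" "card T = s - card B"
      then have "finite T" "T \<inter> B = {}"
        using assms(1) finite_subset[of T A] by auto
      then show "T \<union> B \<subseteq> A \<and> card (T \<union> B) = s \<and> B \<subseteq> T \<union> B"
        using T assms finB by (auto simp: card_Un_disjoint)
    qed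
    show "(\<lambda>S. S - B) ` {S. S \<subseteq> A \<and> card S = s \<and> B \<subseteq> S} \<subseteq> {T. T \<subseteq> A - B \<and> card T = s - card B}"
      using finB by (auto simp: card_Diff_subset)
  qed auto
  then have "card {S. S \<subseteq> A \<and> card S = s \<and> B \<subseteq> S} = card {T. T \<subseteq> A - B \<and> card T = s - card B}"
    by (rule bij_betw_same_card[symmetric])
  also have "\<dots> = (card A - card B) choose (s - card B)"
    using assms finB by (simp add: n_subsets card_Diff_subset)
  finally show ?thesis .
qed

lemma card_corners:
  assumes "D \<subseteq> chords S" "x \<in> crossings D"
  shows "card (corners x) = 4" "corners x \<subseteq> S"
  using assms by (auto simp: crossings_def corners_def chords_def interleave_def)

text \<open>Double counting: a crossing has four distinct corners and therefore appears in
  \<open>(n - 4) choose (s - 4)\<close> samples.\<close>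

lemma sum_crossings_subsets:
  assumes "D \<subseteq> chords {..<n}" "4 \<le> s"
  shows "(\<Sum>S | S \<subseteq> {..<n} \<and> card S = s. card {x \<in> crossings D. corners x \<subseteq> S})
    = card (crossings D) * ((n - 4) choose (s - 4))"
proof -
  have "finite D"
    using assms(1) finite_chords[of "{..<n}"] finite_subset by blast
  have "(\<Sum>S | S \<subseteq> {..<n} \<and> card S = s. card {x \<in> crossings D. corners x \<subseteq> S})
      = (\<Sum>x\<in>crossings D. (n - 4) choose (s - 4))"
  proof (rule sum_multicount_gen)
    show "\<forall>x\<in>crossings D. card {S \<in> {S. S \<subseteq> {..<n} \<and> card S = s}. corners x \<subseteq> S} = (n - 4) choose (s - 4)"
    proof
      fix x assume "x \<in> crossings D"
      then show "card {S \<in> {S. S \<subseteq> {..<n} \<and> card S = s}. corners x \<subseteq> S} = (n - 4) choose (s - 4)"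
        using card_supersets[of "{..<n}" "corners x" s] card_corners[OF assms(1), of x] assms(2)
        by (simp add: conj_assoc)
    qed
  qed (use \<open>finite D\<close> in \<open>auto simp: finite_crossings\<close>)
  then show ?thesis
    by simp
qed

text \<open>Handshake argument: every crossing is seen from both of its chords.\<close>

lemma card_crossings_le_degree:
  assumes "finite D"
    and deg: "\<And>e. e \<in> D \<Longrightarrow> card {f \<in> D. interleave e f \<or> interleave f e} \<le> k"
  shows "2 * card (crossings D) \<le> k * card D"
proof -
  have "crossings D = (SIGMA e:D. {f \<in> D. interleave e f})"
    by (auto simp: crossings_def)
  then have 1: "card (crossings D) = (\<Sum>e\<in>D. card {f \<in> D. interleave e f})"
    using assms(1) by (simp add: card_SigmaI)
  have 2: "(\<Sum>e\<in>D. card {f \<in> D. interleave e f}) = (\<Sum>f\<in>D. card {e \<in> D. interleave e f})"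
    using assms(1) by (intro sum_multicount_gen) auto
  have 3: "card {f \<in> D. interleave e f \<or> interleave f e}
      = card {f \<in> D. interleave e f} + card {f \<in> D. interleave f e}" for e
  proof -
    have "{f \<in> D. interleave e f} \<inter> {f \<in> D. interleave f e} = {}"
      by (auto simp: interleave_def)
    moreover have "{f \<in> D. interleave e f \<or> interleave f e}
        = {f \<in> D. interleave e f} \<union> {f \<in> D. interleave f e}"
      by auto
    ultimately show ?thesis
      using assms(1) by (simp add: card_Un_disjoint)
  qed
  have "2 * card (crossings D) = (\<Sum>e\<in>D. card {f \<in> D. interleave e f \<or> interleave f e})"
    unfolding 3 sum.distrib using 1 2 by linarith
  also have "\<dots> \<le> (\<Sum>e\<in>D. k)"
    by (intro sum_mono deg)
  finally show ?thesis
    by (simp add: mult.commute)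
qed

text \<open>The probability that a random \<open>s\<close>-subset contains four given vertices,
  cleared of denominators. The absorption identity \<open>*\<close> is applied four times.\<close>

lemma falling_binomial:
  assumes "4 \<le> s" "s \<le> n"
  shows "real n * (real n - 1) * (real n - 2) * (real n - 3) * real ((n - 4) choose (s - 4))
    = real s * (real s - 1) * (real s - 2) * (real s - 3) * real (n choose s)"
proof -
  define m r where "m = n - 4" and "r = s - 4"
  have mr: "n = Suc (Suc (Suc (Suc m)))" "s = Suc (Suc (Suc (Suc r)))"
    using assms by (simp_all add: m_def r_def)
  have *: "real (Suc a) * real (a choose b) = real (Suc b) * real (Suc a choose Suc b)" for a b
    by (metis Suc_times_binomial of_nat_mult)
  have "real n * (real n - 1) * (real n - 2) * (real n - 3) * real (m choose r)
      = real n * (real n - 1) * (real n - 2) * (real (Suc m) * real (m choose r))"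
    by (simp add: mr)
  also have "\<dots> = real (Suc r) * (real n * (real n - 1) * (real (Suc (Suc m)) * real (Suc m choose Suc r)))"
    by (subst *) (simp add: mr)
  also have "\<dots> = real (Suc r) * real (Suc (Suc r))
      * (real n * (real (Suc (Suc (Suc m))) * real (Suc (Suc m) choose Suc (Suc r))))"
    by (subst *) (simp add: mr)
  also have "\<dots> = real (Suc r) * real (Suc (Suc r)) * real (Suc (Suc (Suc r)))
      * (real n * real (Suc (Suc (Suc m)) choose Suc (Suc (Suc r))))"
    by (subst *) simp
  also have "\<dots> = real (Suc r) * real (Suc (Suc r)) * real (Suc (Suc (Suc r))) * real s * real (n choose s)"
    unfolding mr by (subst *) simp
  finally show ?thesis
    by (simp add: mr mult_ac)
qed

text \<open>The number \<open>X\<close> of crossings within parts is estimated twice: from above by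
  the degrees, from below by averaging over all \<open>s\<close>-subsets.\<close>

lemma chord_partition_bound:
  fixes D :: "'h \<Rightarrow> (nat \<times> nat) set"
  assumes "finite I" and union: "(\<Union>h\<in>I. D h) = chords {..<n}"
    and disj: "\<And>h h'. \<lbrakk>h \<in> I; h' \<in> I; h \<noteq> h'\<rbrakk> \<Longrightarrow> D h \<inter> D h' = {}"
    and deg: "\<And>h e. \<lbrakk>h \<in> I; e \<in> D h\<rbrakk> \<Longrightarrow> card {f \<in> D h. interleave e f \<or> interleave f e} \<le> k"
    and s: "4 \<le> s" "s \<le> n"
  shows "(real s / 2 - real (card I)) * ((real n - 2) * (real n - 3))
    \<le> real k * (real s * (real s - 1) * (real s - 2)) / 4"
proof -
  have sub: "D h \<subseteq> chords {..<n}" if "h \<in> I" for h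
    using union that by blast
  have fin: "finite (D h)" if "h \<in> I" for h
    using sub[OF that] finite_chords[of "{..<n}"] finite_subset by blast
  define X where "X = (\<Sum>h\<in>I. card (crossings (D h)))"
  define F where "F = {S. S \<subseteq> {..<n} \<and> card S = s}"
  have cardF: "card F = n choose s"
    using n_subsets[of "{..<n}" s] by (simp add: F_def)
  have "2 * X = (\<Sum>h\<in>I. 2 * card (crossings (D h)))"
    by (simp add: X_def sum_distrib_left)
  also have "\<dots> \<le> (\<Sum>h\<in>I. k * card (D h))"
    by (intro sum_mono card_crossings_le_degree fin deg)
  also have "\<dots> = k * card (\<Union>h\<in>I. D h)"
    using assms(1) fin disj by (subst card_UN_disjoint) (auto simp: sum_distrib_left)
  also have "\<dots> = k * (n choose 2)"
    by (simp add: union card_chords)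
  finally have X: "2 * X \<le> k * (n choose 2)" .
  \<comment> \<open>A sample has at most \<open>s\<close> sides, subtracted once for all parts; its
    diagonals are distributed over the parts, and each part holds at most \<open>s - 3\<close> plus
    its number of crossings in the sample.\<close>
  have S: "s choose 2 \<le> card I * (s - 3) + (\<Sum>h\<in>I. card {x \<in> crossings (D h). corners x \<subseteq> S}) + s"
    if "S \<in> F" for S
  proof -
    have S: "S \<subseteq> {..<n}" "finite S" "card S = s" "S \<noteq> {}"
      using that s finite_subset[of S "{..<n}"] by (auto simp: F_def)
    have "diagonals S \<subseteq> chords {..<n}"
      using S(1) by (auto simp: diagonals_def chords_def)
    then have "diagonals S = (\<Union>h\<in>I. D h \<inter> diagonals S)"
      using union by blast
    then have "card (diagonals S) \<le> (\<Sum>h\<in>I. card (D h \<inter> diagonals S))"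
      using card_UN_le[OF assms(1), of "\<lambda>h. D h \<inter> diagonals S"] by simp
    also have "\<dots> \<le> (\<Sum>h\<in>I. (s - 3) + card {x \<in> crossings (D h). corners x \<subseteq> S})"
      using card_diagonals_le_crossings[OF S(2)] S(3) s fin by (intro sum_mono) simp
    also have "\<dots> = card I * (s - 3) + (\<Sum>h\<in>I. card {x \<in> crossings (D h). corners x \<subseteq> S})"
      by (simp add: sum.distrib)
    finally show ?thesis
      using card_diagonals_ge[OF S(2,4)] unfolding S(3) by linarith
  qed
  have "(\<Sum>S\<in>F. s choose 2)
      \<le> (\<Sum>S\<in>F. card I * (s - 3) + (\<Sum>h\<in>I. card {x \<in> crossings (D h). corners x \<subseteq> S}) + s)"
    by (intro sum_mono S)
  also have "\<dots> = card F * (card I * (s - 3) + s)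
      + (\<Sum>h\<in>I. \<Sum>S\<in>F. card {x \<in> crossings (D h). corners x \<subseteq> S})"
    by (subst sum.swap) (simp add: sum.distrib algebra_simps)
  also have "(\<Sum>h\<in>I. \<Sum>S\<in>F. card {x \<in> crossings (D h). corners x \<subseteq> S})
      = X * ((n - 4) choose (s - 4))"
    using sum_crossings_subsets[OF sub s(1)] by (simp add: F_def X_def sum_distrib_right)
  finally have "(n choose s) * (s choose 2)
      \<le> (n choose s) * (card I * (s - 3) + s) + X * ((n - 4) choose (s - 4))"
    by (simp add: cardF)
  then have "real ((n choose s) * (s choose 2))
      \<le> real ((n choose s) * (card I * (s - 3) + s) + X * ((n - 4) choose (s - 4)))"
    by (rule of_nat_mono)
  then have 1: "real (n choose s) * real (s choose 2)
      \<le> real (n choose s) * (real (card I) * real (s - 3) + real s) + real X * real ((n - 4) choose (s - 4))"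
    by (simp only: of_nat_mult of_nat_add)
  have choose2: "real (m choose 2) = real m * (real m - 1) / 2" for m
    by (cases m) (simp_all add: choose_two real_of_nat_div algebra_simps)
  have s3: "real (s - 3) = real s - 3"
    using s by simp
  have main: "real (n choose s) * (real s * (real s - 1) / 2 - (real (card I) * (real s - 3) + real s))
      \<le> real X * real ((n - 4) choose (s - 4))"
    using 1 unfolding choose2 s3 right_diff_distrib by linarith
  define N where "N = real (n choose s)"
  define B where "B = real ((n - 4) choose (s - 4))"
  have pos: "N > 0" "B \<ge> 0" "real n - 2 > 0" "real n - 3 > 0" "real s - 3 > 0"
    using s by (auto simp: N_def B_def)
  have "2 * real X \<le> real k * (real n * (real n - 1) / 2)"
    using of_nat_mono[OF X, where 'a = real] by (simp add: choose2)
  then have "real X \<le> real k * (real n * (real n - 1)) / 4"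
    by simp
  then have "real X * B \<le> real k * (real n * (real n - 1)) / 4 * B"
    using pos by (intro mult_right_mono)
  \<comment> \<open>Since \<open>s (s - 1) / 2 - s = s (s - 3) / 2\<close>, the factor
    \<open>s - 3\<close> splits off on the left. It cancels at the end against the last factor of
    the falling factorial of \<open>s\<close>.\<close>
  with main have "N * ((real s - 3) * (real s / 2 - real (card I))) \<le> real k * (real n * (real n - 1)) / 4 * B"
    by (simp add: N_def B_def field_simps)
  \<comment> \<open>The factors \<open>n - 2\<close> and \<open>n - 3\<close> complete the
    \<open>n (n - 1)\<close> from the number of chords to the falling factorial of
    \<open>falling_binomial\<close>.\<close>
  then have "N * ((real s - 3) * (real s / 2 - real (card I))) * ((real n - 2) * (real n - 3))
      \<le> real k * (real n * (real n - 1)) / 4 * B * ((real n - 2) * (real n - 3))"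
    using pos by (intro mult_right_mono) auto
  also have "\<dots> = real k / 4 * (real n * (real n - 1) * (real n - 2) * (real n - 3) * B)"
    by simp
  also have "\<dots> = real k / 4 * (real s * (real s - 1) * (real s - 2) * (real s - 3) * N)"
    unfolding B_def N_def by (subst falling_binomial[OF s]) simp
  finally have "(N * (real s - 3)) * ((real s / 2 - real (card I)) * ((real n - 2) * (real n - 3)))
      \<le> (N * (real s - 3)) * (real k * (real s * (real s - 1) * (real s - 2)) / 4)"
    by (simp only: mult_ac times_divide_eq_left times_divide_eq_right)
  then show ?thesis
    using pos by (simp only: mult_le_cancel_left_pos mult_pos_pos)
qed

text \<open>The averaging bound is applied with subsets of size \<open>\<lfloor>x\<rfloor>\<close>, where \<open>x = (n - 1) / \<surd>k\<close>.\<close>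

lemma chord_partition_card_ge:
  fixes D :: "'h \<Rightarrow> (nat \<times> nat) set"
  assumes "finite I" and union: "(\<Union>h\<in>I. D h) = chords {..<n}"
    and disj: "\<And>h h'. \<lbrakk>h \<in> I; h' \<in> I; h \<noteq> h'\<rbrakk> \<Longrightarrow> D h \<inter> D h' = {}"
    and deg: "\<And>h e. \<lbrakk>h \<in> I; e \<in> D h\<rbrakk> \<Longrightarrow> card {f \<in> D h. interleave e f \<or> interleave f e} \<le> k"
    and k: "k > 0" and large: "4 * sqrt (real k) \<le> real n - 1"
  shows "real (card I) \<ge> (real n - 1) / (4 * sqrt (real k))"
proof -
  define r where "r = sqrt (real k)"
  define x where "x = (real n - 1) / r"
  define s where "s = nat \<lfloor>x\<rfloor>"
  have r: "r \<ge> 1" "r\<^sup>2 = real k"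
    using k by (auto simp: r_def)
  have n: "real n - 1 = x * r"
    using r by (simp add: x_def)
  have x: "x \<ge> 4"
    using large r by (simp add: x_def r_def field_simps)
  have fl: "4 \<le> \<lfloor>x\<rfloor>"
    using x by (simp add: le_floor_iff)
  then have "real s = of_int \<lfloor>x\<rfloor>"
    by (simp add: s_def)
  then have s: "real s \<le> x" "x < real s + 1" "4 \<le> s"
    using fl floor_correct[of x] by (simp_all add: s_def le_nat_iff)
  have "x * 1 \<le> x * r"
    using r x by (intro mult_left_mono) auto
  then have "real s \<le> real n - 1"
    using s n by linarith
  then have sn: "s \<le> n" "4 \<le> n" "real n \<ge> 5"
    using s(3) by linarith+
  let ?t = "real (card I)" and ?s = "real s"
  have "(?s / 2 - ?t) * ((real n - 2) * (real n - 3)) \<le> real k * (?s * (?s - 1) * (?s - 2)) / 4"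
    by (rule chord_partition_bound[OF assms(1) union disj deg s(3) sn(1)])
  \<comment> \<open>The factor \<open>x^2\<close> absorbs \<open>k\<close>: together they are
    \<open>(x * r)^2\<close>, and \<open>x * r\<close> is \<open>n - 1\<close>.\<close>
  then have "(?s / 2 - ?t) * ((real n - 2) * (real n - 3)) * x\<^sup>2
      \<le> real k * (?s * (?s - 1) * (?s - 2)) / 4 * x\<^sup>2"
    by (intro mult_right_mono) auto
  also have "\<dots> = ?s / 4 * (((?s - 1) * (x * r)) * ((?s - 2) * (x * r)))"
    by (simp add: r(2)[symmetric] power2_eq_square)
  also have "\<dots> \<le> ?s / 4 * ((?s * (real n - 2)) * (?s * (real n - 3)))"
  proof (intro mult_left_mono)
    have "?s \<le> x * r" and "real n = x * r + 1"
      using \<open>real s \<le> real n - 1\<close> n by simp_all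
    \<comment> \<open>The right sides exceed the left ones by \<open>n - 1 - s\<close> and
      \<open>2 (n - 1 - s)\<close>.\<close>
    then have "(?s - 1) * (x * r) \<le> ?s * (real n - 2)" "(?s - 2) * (x * r) \<le> ?s * (real n - 3)"
      by (simp_all add: algebra_simps)
    then show "((?s - 1) * (x * r)) * ((?s - 2) * (x * r)) \<le> (?s * (real n - 2)) * (?s * (real n - 3))"
      using s sn r x by (intro mult_mono[of "(?s - 1) * (x * r)"]) auto
  qed simp
  also have "\<dots> = (?s ^ 3 / 4) * ((real n - 2) * (real n - 3))"
    by (simp add: power3_eq_cube)
  finally have "((?s / 2 - ?t) * x\<^sup>2) * ((real n - 2) * (real n - 3)) \<le> (?s ^ 3 / 4) * ((real n - 2) * (real n - 3))"
    by (simp only: mult.assoc mult.commute mult.left_commute)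
  then have "(?s / 2 - ?t) * x\<^sup>2 \<le> ?s ^ 3 / 4"
    using sn by (simp only: mult_le_cancel_right) auto
  \<comment> \<open>Equality would hold at \<open>s = x\<close>. The difference is
    \<open>(x - s) (s (s + x) - x^2) / 4\<close>, which is nonnegative by
    \<open>s \<ge> x - 1\<close> and \<open>x \<ge> 4\<close>, so rounding \<open>x\<close> down
    loses nothing.\<close>
  moreover have "x ^ 3 / 4 \<le> ?s / 2 * x\<^sup>2 - ?s ^ 3 / 4"
  proof -
    have "?s * (?s + x) \<ge> (x - 1) * (x - 1 + x)"
      using s x by (intro mult_mono) auto
    moreover have "(x - 1) * (x - 1 + x) - x\<^sup>2 = x * (x - 3) + 1"
      by (simp add: algebra_simps power2_eq_square)
    moreover have "x * (x - 3) \<ge> 0"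
      using x by simp
    ultimately have "?s * (?s + x) - x\<^sup>2 \<ge> 0"
      by linarith
    then have "(x - ?s) * (?s * (?s + x) - x\<^sup>2) \<ge> 0"
      using s by simp
    then show ?thesis
      by (simp add: algebra_simps power2_eq_square power3_eq_cube)
  qed
  ultimately have "x / 4 * x\<^sup>2 \<le> ?t * x\<^sup>2"
    by (simp add: algebra_simps power2_eq_square power3_eq_cube)
  then have "x / 4 \<le> ?t"
    using x by simp
  then show ?thesis
    by (simp add: x_def r_def)
qed

section \<open>Partitions into k-planar subgraphs\<close>

lemma k_planar_mono: "\<lbrakk>k_planar k G; k \<le> l\<rbrakk> \<Longrightarrow> k_planar l G"
  by (force simp: k_planar_def)

lemma finite_subgraphs:
  assumes "finite (verts G)" "finite (edges G)"
  shows "finite {H. subgraph H G}"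
proof (rule finite_subset)
  show "{H. subgraph H G} \<subseteq> (\<lambda>(V, E). \<lparr>verts = V, edges = E\<rparr>) ` (Pow (verts G) \<times> Pow (edges G))"
  proof
    fix H :: geo_graph
    assume "H \<in> {H. subgraph H G}"
    then have "(verts H, edges H) \<in> Pow (verts G) \<times> Pow (edges G)"
      by (simp add: subgraph_def)
    moreover have "H = (\<lambda>(V, E). \<lparr>verts = V, edges = E\<rparr>) (verts H, edges H)"
      by simp
    ultimately show "H \<in> (\<lambda>(V, E). \<lparr>verts = V, edges = E\<rparr>) ` (Pow (verts G) \<times> Pow (edges G))"
      by blast
  qed
qed (use assms in simp)

context ccw_polygon
begin

text \<open>A partition is an arbitrary set of graphs, and \<open>card\<close> would be 0 on an
  infinite one; a lower bound on \<open>card\<close> therefore needs finiteness.\<close>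

lemma finite_partition:
  assumes "graph_partition \<H> (complete_geometric_graph (v ` {..<n}))"
  shows "finite \<H>"
proof (rule finite_subset)
  show "\<H> \<subseteq> {H. subgraph H (complete_geometric_graph (v ` {..<n}))}"
    using assms by (auto simp: graph_partition_def)
qed (intro finite_subgraphs; simp add: complete_geometric_graph_def)

text \<open>The parts are pulled back along \<open>draw\<close> to sets of chords. Injectivity of
  \<open>draw\<close> keeps the crossing degrees at most \<open>k\<close>.\<close>

lemma k_planar_partition_card_ge:
  assumes part: "graph_partition \<H> (complete_geometric_graph (v ` {..<n}))"
    and planar: "\<And>H. H \<in> \<H> \<Longrightarrow> k_planar k H"
    and k: "k > 0" and large: "4 * sqrt (real k) \<le> real n - 1"
  shows "real (card \<H>) \<ge> (real n - 1) / (4 * sqrt (real k))"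
proof -
  define D where "D H = {e \<in> chords {..<n}. draw e \<in> edges H}" for H :: geo_graph
  have sub: "edges H \<subseteq> draw ` chords {..<n}" if "H \<in> \<H>" for H
    using part that unfolding draw_image_chords
    by (auto simp: graph_partition_def subgraph_def complete_geometric_graph_def)
  have union: "(\<Union>H\<in>\<H>. D H) = chords {..<n}"
  proof (intro equalityI subsetI)
    fix e assume e: "e \<in> chords {..<n}"
    then have "draw e \<in> (\<Union>H\<in>\<H>. edges H)"
      using part draw_image_chords by (auto simp: graph_partition_def complete_geometric_graph_def)
    then show "e \<in> (\<Union>H\<in>\<H>. D H)"
      using e by (auto simp: D_def)
  qed (auto simp: D_def)
  have disj: "D H \<inter> D H' = {}" if "H \<in> \<H>" "H' \<in> \<H>" "H \<noteq> H'" for H H'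
    using part that by (auto simp: D_def graph_partition_def)
  have deg: "card {f \<in> D H. interleave e f \<or> interleave f e} \<le> k" if "H \<in> \<H>" "e \<in> D H" for H e
  proof -
    have e: "e \<in> chords {..<n}" "draw e \<in> edges H"
      using that(2) by (auto simp: D_def)
    have "finite (edges H)"
      using sub[OF that(1)] finite_chords[of "{..<n}"] by (meson finite_imageI finite_lessThan finite_subset)
    have "inj_on draw {f \<in> D H. interleave e f \<or> interleave f e}"
      by (rule inj_on_subset[OF inj_draw]) (auto simp: D_def)
    moreover have "draw ` {f \<in> D H. interleave e f \<or> interleave f e} \<subseteq> {f \<in> edges H. crosses (draw e) f}"
      using crosses_iff_interleave[OF e(1)] by (auto simp: D_def)
    ultimately have "card {f \<in> D H. interleave e f \<or> interleave f e} \<le> card {f \<in> edges H. crosses (draw e) f}"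
      using \<open>finite (edges H)\<close> by (intro card_inj_on_le) auto
    also have "\<dots> \<le> k"
      using planar[OF that(1)] e(2) by (simp add: k_planar_def)
    finally show ?thesis .
  qed
  show ?thesis
    by (rule chord_partition_card_ge[OF finite_partition[OF part] union disj deg k large])
qed

text \<open>A partition also has to cover the vertices, so a part exists even for
  \<open>n = 1\<close>, where there are no edges.\<close>

lemma partition_nonempty:
  assumes "graph_partition \<H> (complete_geometric_graph (v ` {..<n}))" "n > 0"
  shows "card \<H> \<ge> 1"
proof -
  have "\<H> \<noteq> {}"
    using assms by (auto simp: graph_partition_def complete_geometric_graph_def)
  then show ?thesis
    using finite_partition[OF assms(1)] by (simp add: Suc_le_eq card_gt_0_iff)
qed

end

text \<open>Rounding up gives \<open>s - 1 < sqrt (2 * k)\<close>, hence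
  \<open>(s - 1) (s - 2) \<le> (s - 1)^2 \<le> 2 * k\<close>.\<close>

lemma ceiling_sqrt_bounds:
  assumes "k > 0"
  defines "s \<equiv> nat \<lceil>sqrt (2 * real k)\<rceil>"
  shows "s > 0" "sqrt (2 * real k) \<le> real s" "(s - 1) * (s - 2) div 2 \<le> k"
proof -
  let ?r = "sqrt (2 * real k)"
  have pos: "?r > 0"
    using assms(1) by simp
  then have "\<lceil>?r\<rceil> > 0"
    by simp
  then show s: "s > 0"
    by (simp add: s_def)
  show "?r \<le> real s"
    unfolding s_def by (rule real_nat_ceiling_ge)
  have "real s < ?r + 1"
    using \<open>\<lceil>?r\<rceil> > 0\<close> ceiling_correct[of ?r] by (simp add: s_def)
  then have "real (s - 1) \<le> ?r"
    using s by (simp add: of_nat_diff Suc_le_eq)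
  then have "(real (s - 1))\<^sup>2 \<le> ?r\<^sup>2"
    by (intro power_mono) auto
  then have "real ((s - 1)\<^sup>2) \<le> real (2 * k)"
    by simp
  then have "(s - 1)\<^sup>2 \<le> 2 * k"
    by (simp only: of_nat_le_iff)
  moreover have "(s - 1) * (s - 2) \<le> (s - 1)\<^sup>2"
    unfolding power2_eq_square by (intro mult_left_mono) auto
  ultimately show "(s - 1) * (s - 2) div 2 \<le> k"
    by linarith
qed

theorem theorem2:
  fixes P :: "point set" and n :: nat
  assumes "finite P" and "card P = n"
    and "convex_position P" and "general_position P"
  shows "(\<forall>k::nat. k > 0 \<longrightarrow>
            (\<exists>\<H>. graph_partition \<H> (complete_geometric_graph P) \<and>
                 (\<forall>H\<in>\<H>. k_planar k H) \<and>
                 int (card \<H>) \<le> \<lceil>real n / sqrt (2 * real k)\<rceil>))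
       \<and> (\<forall>s::nat. s > 2 \<longrightarrow>
            (\<exists>\<H>. graph_partition \<H> (complete_geometric_graph P) \<and>
                 (\<forall>H\<in>\<H>. k_planar ((s - 1) * (s - 2) div 2) H) \<and>
                 int (card \<H>) = \<lceil>real n / real s\<rceil>))
       \<and> (\<forall>k::nat. k > 0 \<longrightarrow>
            (\<forall>\<H>. graph_partition \<H> (complete_geometric_graph P) \<and>
                 (\<forall>H\<in>\<H>. k_planar k H) \<longrightarrow>
                 real (card \<H>) \<ge> (real n - 1) / (4.93 * sqrt (real k))))"
proof -
  obtain v :: "nat \<Rightarrow> point" where bij: "bij_betw v {..<card P} P"
    and ccw: "\<And>i j k. \<lbrakk>i < j; j < k; k < card P\<rbrakk> \<Longrightarrow> orient (v i) (v j) (v k) > 0"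
    using ccw_enumeration[OF assms(1,3,4)] by blast
  interpret ccw_polygon v n
    using bij ccw assms(2) by unfold_locales (auto simp: bij_betw_def)
  have P: "v ` {..<n} = P"
    using bij assms(2) by (simp add: bij_betw_def)
  \<comment> \<open>Stated for all \<open>s > 0\<close>, because the first claim uses it with
    \<open>s = 2\<close> when \<open>k\<close> is 1 or 2.\<close>
  have groups: "\<exists>\<H>. graph_partition \<H> (complete_geometric_graph P) \<and>
      (\<forall>H\<in>\<H>. k_planar ((s - 1) * (s - 2) div 2) H) \<and> int (card \<H>) = \<lceil>real n / real s\<rceil>"
    if "s > 0" for s
    using partition_into_groups[of s] assms(4) that by (simp only: P)
  show ?thesis
  proof (intro conjI allI impI)
    fix k :: nat assume k: "k > 0"
    define s where "s = nat \<lceil>sqrt (2 * real k)\<rceil>"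
    have s: "s > 0" "sqrt (2 * real k) \<le> real s" "(s - 1) * (s - 2) div 2 \<le> k"
      using ceiling_sqrt_bounds[OF k] by (simp_all add: s_def)
    obtain \<H> where \<H>: "graph_partition \<H> (complete_geometric_graph P)"
      "\<forall>H\<in>\<H>. k_planar ((s - 1) * (s - 2) div 2) H" "int (card \<H>) = \<lceil>real n / real s\<rceil>"
      using groups[OF s(1)] by blast
    have "real n / real s \<le> real n / sqrt (2 * real k)"
      using s(1,2) k by (intro divide_left_mono) auto
    then have "int (card \<H>) \<le> \<lceil>real n / sqrt (2 * real k)\<rceil>"
      unfolding \<H>(3) by (rule ceiling_mono)
    then show "\<exists>\<H>. graph_partition \<H> (complete_geometric_graph P) \<and>
        (\<forall>H\<in>\<H>. k_planar k H) \<and> int (card \<H>) \<le> \<lceil>real n / sqrt (2 * real k)\<rceil>"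
      using \<H> k_planar_mono[OF _ s(3)] by blast
  next
    fix s :: nat assume "s > 2"
    then show "\<exists>\<H>. graph_partition \<H> (complete_geometric_graph P) \<and>
        (\<forall>H\<in>\<H>. k_planar ((s - 1) * (s - 2) div 2) H) \<and> int (card \<H>) = \<lceil>real n / real s\<rceil>"
      by (intro groups) simp
  next
    fix k :: nat and \<H>
    assume k: "k > 0"
      and H: "graph_partition \<H> (complete_geometric_graph P) \<and> (\<forall>H\<in>\<H>. k_planar k H)"
    then have part: "graph_partition \<H> (complete_geometric_graph (v ` {..<n}))"
      and planar: "\<And>H. H \<in> \<H> \<Longrightarrow> k_planar k H"
      by (simp_all add: P)
    have r: "sqrt (real k) > 0"
      using k by simp
    show "real (card \<H>) \<ge> (real n - 1) / (4.93 * sqrt (real k))"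
    \<comment> \<open>For large \<open>n\<close> the averaging argument gives the constant 4, which
      is better than 4.93. For small \<open>n\<close> the claimed bound is below 1, so a single part
      is enough, and for \<open>n = 0\<close> it is negative.\<close>
    proof (cases "4 * sqrt (real k) \<le> real n - 1")
      case True
      then have "0 \<le> real n - 1"
        using r by linarith
      then have "(real n - 1) / (4.93 * sqrt (real k)) \<le> (real n - 1) / (4 * sqrt (real k))"
        using r by (intro divide_left_mono mult_right_mono) auto
      also have "\<dots> \<le> real (card \<H>)"
        by (rule k_planar_partition_card_ge[OF part planar k True])
      finally show ?thesis .
    next
      case small: False
      show ?thesis
      proof (cases "n = 0")
        case True
        have "(real n - 1) / (4.93 * sqrt (real k)) \<le> 0"
          using True by simp
        then show ?thesis
          by (rule order_trans) simp
      next
        case False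
        then have "1 \<le> real (card \<H>)"
          using partition_nonempty[OF part] by simp
        moreover have "(real n - 1) / (4.93 * sqrt (real k)) \<le> 1"
        proof -
          have "real n * 100 - 100 \<le> 493 * sqrt (real k)"
            using small r by linarith
          then show ?thesis
            using r by simp
        qed
        ultimately show ?thesis
          by linarith
      qed
    qed
  qed
qed

end
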